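(* Let $n\ge 2$ be divisible by $4$ and $D\subseteq\{d : d\mid n,\ 1\le d<n\}$. If $\mathrm{ICG}_n(D)$ has perfect state transfer then either $n/2\in D$ or $n/4\in D$, but not both.
   Context: $\mathrm{ICG}_n(D)$ is the graph on $\mathbb{Z}_n=\{0,\dots,n-1\}$ where $a,b$ are adjacent iff $\gcd(a-b,n)\in D$. With $A$ its adjacency matrix and $F(t)=\exp(\mathrm{i}At)$, the graph has perfect state transfer if there exist distinct vertices $a,b$ and $\tau>0$ with $|F(\tau)_{ab}|=1$. *)

theory Defs
  imports Complex_Main "Jordan_Normal_Form.Jordan_Normal_Form"
begin

definition adjacency_matrix :: "nat \<Rightarrow> (nat \<Rightarrow> nat \<Rightarrow> bool) \<Rightarrow> complex mat" where
  "adjacency_matrix n E = mat n n (\<lambda>(a, b). if E a b then 1 else 0)"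

text \<open>The matrix exponential of a square matrix is the sum of the power series
  \<open>A\<^sup>k / k!\<close>, taken entrywise; all these entry series converge, see \<open>summable_mat_exp\<close>.\<close>

definition mat_exp :: "complex mat \<Rightarrow> complex mat" where
  "mat_exp A = mat (dim_row A) (dim_row A) (\<lambda>(a, b). \<Sum>k. (A ^\<^sub>m k) $$ (a, b) / fact k)"

definition transition_matrix :: "complex mat \<Rightarrow> real \<Rightarrow> complex mat" where
  "transition_matrix A t = mat_exp ((\<i> * complex_of_real t) \<cdot>\<^sub>m A)"

definition has_perfect_state_transfer :: "nat \<Rightarrow> (nat \<Rightarrow> nat \<Rightarrow> bool) \<Rightarrow> bool" where
  "has_perfect_state_transfer n E \<longleftrightarrow>
     (\<exists>a<n. \<exists>b<n. a \<noteq> b \<and>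
       (\<exists>\<tau>>0. cmod (transition_matrix (adjacency_matrix n E) \<tau> $$ (a, b)) = 1))"

text \<open>Vertices are the representatives \<open>0, \<dots>, n - 1\<close> of the residues modulo \<open>n\<close>; the
  difference is formed in \<open>int\<close> because subtraction on \<open>nat\<close> truncates.\<close>

definition ICG :: "nat \<Rightarrow> nat set \<Rightarrow> nat \<Rightarrow> nat \<Rightarrow> bool" where
  "ICG n D a b \<longleftrightarrow> gcd (int a - int b) (int n) \<in> int ` D"

lemma summable_mat_exp:
  assumes A: "A \<in> carrier_mat n n" and ab: "a < n" "b < n"
  shows "summable (\<lambda>k. (A ^\<^sub>m k) $$ (a, b) / (fact k :: complex))"
proof -
  obtain c where c: "norm_bound A c"
    using norm_bound_max[of A] by auto
  have bound: "norm_bound (A ^\<^sub>m k) ((c * real n) ^ k)" for k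
  proof (induction k)
    case 0
    show ?case using A by (auto simp: norm_bound_def)
  next
    case (Suc k)
    have "norm_bound (A ^\<^sub>m k * A) ((c * real n) ^ k * c * of_nat n)"
      by (rule norm_bound_mult[OF pow_carrier_mat[OF A] A Suc.IH c])
    then show ?case by (simp add: mult_ac)
  qed
  have entry: "cmod ((A ^\<^sub>m k) $$ (a, b)) \<le> (c * real n) ^ k" for k
    using bound[of k] ab A unfolding norm_bound_def by auto
  show ?thesis
  proof (rule summable_comparison_test')
    show "summable (\<lambda>k. inverse (fact k) * (c * real n) ^ k)"
      by (rule summable_exp)
    show "norm ((A ^\<^sub>m k) $$ (a, b) / (fact k :: complex)) \<le> inverse (fact k) * (c * real n) ^ k"
      if "k \<ge> 0" for k
      using entry[of k] by (simp add: norm_divide divide_simps)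
  qed
qed

end

theory Submission
  imports Defs
begin

text \<open>Let \<open>\<lambda>\<^sub>j\<close> be the eigenvalues and \<open>e\<close> the basic character of \<open>\<int>\<^sub>n\<close>. Perfect state transfer
  between \<open>a\<close> and \<open>b\<close> is the equality case of the triangle inequality for
  \<open>n F(t)\<^sub>a\<^sub>b = (\<Sum>j. exp (i t \<lambda>\<^sub>j) e (j (a - b)))\<close>, so all these summands agree. As
  \<open>\<lambda>\<^sub>-\<^sub>1 = \<lambda>\<^sub>1\<close>, this forces \<open>e (a - b) = -1\<close>. Write \<open>n = 4 q N\<close> with \<open>q\<close> a power of two and
  \<open>N\<close> odd, and let \<open>h\<^sub>r\<close> be the sum of the \<open>N\<close> eigenvalues \<open>\<lambda>\<^sub>j\<close> with \<open>j = r\<close> modulo \<open>4 q\<close>.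
  Multiplying \<open>N\<close> summands gives \<open>- exp (i t h\<^sub>1) = exp (i t h\<^sub>2)\<close>, because \<open>N\<close> is odd; hence
  \<open>h\<^sub>1 \<noteq> h\<^sub>2\<close>. On the other hand, if \<open>\<chi>\<close> is the indicator of the connection set, then
  \<open>h\<^sub>1 = - N \<chi>(n/2)\<close> and \<open>h\<^sub>2 = N (\<chi>(n/2) - 2 \<chi>(n/4))\<close>, so \<open>\<chi>(n/2) \<noteq> \<chi>(n/4)\<close>.\<close>

section \<open>Periodic functions on the integers and their sums over one period\<close>

lemma periodic_mult:
  fixes g :: "int \<Rightarrow> 'a" and m :: int
  assumes "\<And>x. g (x + m) = g x"
  shows "g (x + m * k) = g x"
proof (induction k rule: int_induct[where k = 0])
  case base
  show ?case by simp
next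
  case (step1 i)
  show ?case using assms[of "x + m * i"] step1 by (simp add: algebra_simps)
next
  case (step2 i)
  show ?case using assms[of "x + m * (i - 1)"] step2 by (simp add: algebra_simps)
qed

lemma periodic_mod:
  fixes g :: "int \<Rightarrow> 'a" and m :: int
  assumes "\<And>x. g (x + m) = g x"
  shows "g (x mod m) = g x"
  using periodic_mult[of g m "x mod m" "x div m"] assms by simp

lemma sum_periodic_shift:
  fixes g :: "int \<Rightarrow> 'a :: comm_monoid_add" and m :: int
  assumes "\<And>x. g (x + m) = g x" and "m > 0"
  shows "(\<Sum>x\<in>{0..<m}. g (x + b)) = (\<Sum>x\<in>{0..<m}. g x)"
  by (rule sum.reindex_bij_witness[where i = "\<lambda>x. (x - b) mod m" and j = "\<lambda>x. (x + b) mod m"])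
    (use assms in \<open>auto simp: mod_simps periodic_mod[of g m]\<close>)

lemma sum_periodic_uminus:
  fixes g :: "int \<Rightarrow> 'a :: comm_monoid_add" and m :: int
  assumes "\<And>x. g (x + m) = g x" and "m > 0"
  shows "(\<Sum>x\<in>{0..<m}. g (- x)) = (\<Sum>x\<in>{0..<m}. g x)"
  by (rule sum.reindex_bij_witness[where i = "\<lambda>x. (- x) mod m" and j = "\<lambda>x. (- x) mod m"])
    (use assms in \<open>auto simp: mod_simps periodic_mod[of g m]\<close>)

section \<open>Characters of the integers modulo \<open>n\<close>\<close>

definition unit_root :: "nat \<Rightarrow> int \<Rightarrow> complex" where
  "unit_root n x = cis (2 * pi * of_int x / of_nat n)"

lemma unit_root_add: "unit_root n (x + y) = unit_root n x * unit_root n y"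
  by (simp add: unit_root_def cis_mult distrib_left add_divide_distrib)

lemma unit_root_0 [simp]: "unit_root n 0 = 1"
  by (simp add: unit_root_def)

lemma norm_unit_root [simp]: "norm (unit_root n x) = 1"
  by (simp add: unit_root_def)

lemma cnj_unit_root: "cnj (unit_root n x) = unit_root n (- x)"
  by (simp add: unit_root_def cis_cnj)

lemma unit_root_uminus_eq: "unit_root n x = - 1 \<Longrightarrow> unit_root n (- x) = - 1"
  using cnj_unit_root[of n x] by simp

lemma unit_root_eq_1_iff:
  assumes "n > 0"
  shows "unit_root n x = 1 \<longleftrightarrow> int n dvd x"
proof -
  have "unit_root n x = 1 \<longleftrightarrow> (\<exists>k::int. 2 * pi * of_int x / of_nat n = of_int k * 2 * pi)"
    by (auto simp: unit_root_def complex_eq_iff cos_one_2pi_int[symmetric] intro: cos_one_sin_zero)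
  also have "\<dots> \<longleftrightarrow> (\<exists>k::int. real_of_int x = of_int (k * int n))"
    using assms by (intro ex_cong1) (auto simp: field_simps)
  also have "\<dots> \<longleftrightarrow> int n dvd x"
    unfolding of_int_eq_iff by (auto simp: dvd_def mult.commute)
  finally show ?thesis .
qed

lemma unit_root_dvd [simp]: "n > 0 \<Longrightarrow> int n dvd x \<Longrightarrow> unit_root n x = 1"
  by (simp add: unit_root_eq_1_iff)

lemma unit_root_mult_of_nat: "unit_root n (int k * x) = unit_root n x ^ k"
  by (induction k) (simp_all add: unit_root_add distrib_right)

lemma unit_root_cancel:
  "c > 0 \<Longrightarrow> unit_root (c * n) (int c * x) = unit_root n x"
  by (simp add: unit_root_def mult.assoc)

lemma unit_root_half: "n > 0 \<Longrightarrow> unit_root (2 * n) (int n) = - 1"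
  by (simp add: unit_root_def)

text \<open>Orthogonality of characters: shifting \<open>j\<close> by 1 multiplies the sum by
  \<open>unit_root n x\<close>, so it vanishes unless that factor is 1.\<close>

lemma sum_unit_root:
  assumes "n > 0"
  shows "(\<Sum>j\<in>{0..<int n}. unit_root n (j * x)) = (if int n dvd x then of_nat n else 0)"
proof (cases "int n dvd x")
  case True
  then show ?thesis using assms by simp
next
  case False
  let ?S = "\<Sum>j\<in>{0..<int n}. unit_root n (j * x)"
  have "unit_root n ((j + int n) * x) = unit_root n (j * x)" for j
    using assms by (simp add: distrib_right unit_root_add)
  from sum_periodic_shift[of "\<lambda>j. unit_root n (j * x)", OF this, of 1]
  have "?S = unit_root n x * ?S"
    using assms by (simp only: distrib_right unit_root_add sum_distrib_left) (simp add: mult.commute)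
  moreover have "unit_root n x \<noteq> 1"
    using False assms by (simp add: unit_root_eq_1_iff)
  ultimately show ?thesis using False by simp
qed

section \<open>Circulant matrices: powers and exponential from Fourier coefficients\<close>

definition circulant_mat :: "nat \<Rightarrow> (int \<Rightarrow> complex) \<Rightarrow> complex mat" where
  "circulant_mat n f = mat n n (\<lambda>(a, b). f (int a - int b))"

text \<open>For \<open>n\<close>-periodic \<open>f\<close> this is the eigenvalue of
  \<open>circulant_mat n f\<close> at the row vector with entries
  \<open>unit_root n (- (j * c))\<close>.\<close>

definition fourier :: "nat \<Rightarrow> (int \<Rightarrow> complex) \<Rightarrow> int \<Rightarrow> complex" where
  "fourier n f j = (\<Sum>s\<in>{0..<int n}. f s * unit_root n (- (j * s)))"

lemma circulant_mat_carrier: "circulant_mat n f \<in> carrier_mat n n"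
  by (simp add: circulant_mat_def)

lemma fourier_periodic:
  assumes "n > 0"
  shows "fourier n f (j + int n) = fourier n f j"
proof -
  have "unit_root n (- ((j + int n) * s)) = unit_root n (- (j * s))" for s
    using assms unit_root_add[of n "- (j * s)" "- (int n * s)"] by (simp add: algebra_simps)
  then show ?thesis by (simp add: fourier_def)
qed

lemma fourier_translate:
  assumes "n > 0" and per: "\<And>x. f (x + int n) = f x"
  shows "(\<Sum>c\<in>{0..<int n}. f (c - b) * unit_root n (- (j * c)))
    = unit_root n (- (j * b)) * fourier n f j"
proof -
  let ?g = "\<lambda>c. f (c - b) * unit_root n (- (j * c))"
  have g: "?g (c + int n) = ?g c" for c
    using assms(1) per[of "c - b"] unit_root_add[of n "- (j * c)" "- (j * int n)"]
    by (simp add: algebra_simps)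
  have "(\<Sum>c\<in>{0..<int n}. ?g c) = (\<Sum>c\<in>{0..<int n}. ?g (c + b))"
    using sum_periodic_shift[of ?g "int n" b, OF g] assms(1) by simp
  also have "\<dots> = (\<Sum>c\<in>{0..<int n}. unit_root n (- (j * b)) * (f c * unit_root n (- (j * c))))"
    using unit_root_add[of n "- (j * b)"] by (intro sum.cong) (simp_all add: algebra_simps)
  finally show ?thesis by (simp add: fourier_def sum_distrib_left)
qed

lemma int_dvd_diff_iff: "a < n \<Longrightarrow> b < n \<Longrightarrow> int n dvd int a - int b \<longleftrightarrow> a = b"
  using mod_eq_dvd_iff[of "int a" "int n" "int b"] by simp

text \<open>Induction on \<open>k\<close>: the start is orthogonality of characters, and each
  further factor of the matrix multiplies the \<open>j\<close>-th character by its
  eigenvalue.\<close>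

lemma circulant_mat_pow_entry:
  assumes n: "n > 0" and per: "\<And>x. f (x + int n) = f x" and "a < n" "b < n"
  shows "(circulant_mat n f ^\<^sub>m k) $$ (a, b)
    = (\<Sum>j\<in>{0..<int n}. fourier n f j ^ k * unit_root n (j * (int a - int b))) / of_nat n"
  using assms(4)
proof (induction k arbitrary: b)
  case 0
  then show ?case
    using n \<open>a < n\<close> by (simp add: sum_unit_root circulant_mat_def int_dvd_diff_iff)
next
  case (Suc k)
  let ?C = "circulant_mat n f"
  let ?u = "unit_root n"
  have "(?C ^\<^sub>m Suc k) $$ (a, b) = (\<Sum>c\<in>{0..<n}. (?C ^\<^sub>m k) $$ (a, c) * f (int c - int b))"
    using pow_carrier_mat[OF circulant_mat_carrier[of n f], of k] \<open>a < n\<close> Suc.prems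
    by (auto simp: scalar_prod_def circulant_mat_def intro!: sum.cong)
  also have "\<dots> = (\<Sum>c\<in>{0..<n}. (\<Sum>j\<in>{0..<int n}. fourier n f j ^ k * ?u (j * (int a - int c)))
      / of_nat n * f (int c - int b))"
    by (intro sum.cong) (simp_all add: Suc.IH)
  also have "\<dots> = (\<Sum>c\<in>{0..<int n}. (\<Sum>j\<in>{0..<int n}. fourier n f j ^ k * ?u (j * (int a - c)))
      / of_nat n * f (c - int b))"
    using sum.atLeast_int_lessThan_int_shift[of "\<lambda>c. (\<Sum>j\<in>{0..<int n}. fourier n f j ^ k
      * ?u (j * (int a - c))) / of_nat n * f (c - int b)" 0 n]
    by simp
  also have "\<dots> = (\<Sum>j\<in>{0..<int n}. \<Sum>c\<in>{0..<int n}. fourier n f j ^ k * ?u (j * int a)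
      * (f (c - int b) * ?u (- (j * c)))) / of_nat n"
    unfolding sum_divide_distrib sum_distrib_right
    by (subst sum.swap) (simp add: algebra_simps flip: unit_root_add)
  also have "\<dots> = (\<Sum>j\<in>{0..<int n}. fourier n f j ^ Suc k * ?u (j * (int a - int b))) / of_nat n"
    by (simp only: sum_distrib_left[symmetric] fourier_translate[of n f, OF n per])
      (simp add: algebra_simps flip: unit_root_add)
  finally show ?case .
qed

lemma mat_exp_circulant_entry:
  assumes n: "n > 0" and per: "\<And>x. f (x + int n) = f x" and "a < n" "b < n"
  shows "mat_exp (circulant_mat n f) $$ (a, b)
    = (\<Sum>j\<in>{0..<int n}. exp (fourier n f j) * unit_root n (j * (int a - int b))) / of_nat n"
proof -
  have "(\<lambda>k. z ^ k / fact k) sums exp z" for z :: complex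
    using exp_converges[of z] by (simp add: scaleR_conv_of_real field_simps)
  then have "(\<lambda>k. (\<Sum>j\<in>{0..<int n}. fourier n f j ^ k / fact k * unit_root n (j * (int a - int b)))
      / of_nat n) sums
    ((\<Sum>j\<in>{0..<int n}. exp (fourier n f j) * unit_root n (j * (int a - int b))) / of_nat n)"
    by (intro sums_divide sums_sum sums_mult2)
  then have "(\<lambda>k. (circulant_mat n f ^\<^sub>m k) $$ (a, b) / fact k) sums
    ((\<Sum>j\<in>{0..<int n}. exp (fourier n f j) * unit_root n (j * (int a - int b))) / of_nat n)"
    by (simp add: circulant_mat_pow_entry[of n f, OF n per \<open>a < n\<close> \<open>b < n\<close>] sum_divide_distrib mult.commute)
  then show ?thesis
    using circulant_mat_carrier[of n f] assms by (simp add: mat_exp_def sums_iff)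
qed

section \<open>Equality in the triangle inequality, and state transfer for circulant
  matrices\<close>

lemma norm_sum_eq_card_imp_eq:
  fixes z :: "'a \<Rightarrow> complex"
  assumes "finite I" and unit: "\<And>i. i \<in> I \<Longrightarrow> norm (z i) = 1"
    and norm_sum: "norm (\<Sum>i\<in>I. z i) = card I" and "j \<in> I" "k \<in> I"
  shows "z j = z k"
proof -
  define w where "w = (\<Sum>i\<in>I. z i)"
  define c where "c = real (card I)"
  have c: "c > 0" using assms by (auto simp: c_def card_gt_0_iff)
  have nw: "norm w = c" using norm_sum by (simp add: w_def c_def)
  have norm_le: "norm (cnj w * z i) = c" if "i \<in> I" for i
    using unit[OF that] nw by (simp add: norm_mult)
  have le: "Re (cnj w * z i) \<le> c" if "i \<in> I" for i
    using complex_Re_le_cmod[of "cnj w * z i"] norm_le[OF that] by simp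
  have "(\<Sum>i\<in>I. Re (cnj w * z i)) = Re (cnj w * w)"
    unfolding Re_sum[symmetric] w_def sum_distrib_left ..
  also have "\<dots> = c * c"
    using complex_norm_square[of w] nw
    by (metis Re_complex_of_real mult.commute power2_eq_square)
  \<comment> \<open>No real part exceeds \<open>c\<close>, and the \<open>c\<close> of them add up
    to \<open>c * c\<close>, so each equals \<open>c\<close>.\<close>
  finally have "(\<Sum>i\<in>I. c - Re (cnj w * z i)) = 0"
    by (simp add: sum_subtractf c_def)
  then have "Re (cnj w * z i) = c" if "i \<in> I" for i
    using sum_nonneg_eq_0_iff[of I "\<lambda>i. c - Re (cnj w * z i)"] le that \<open>finite I\<close> by simp
  \<comment> \<open>A number whose real part equals its modulus has no imaginary part.\<close>
  then have "cnj w * z i = of_real c" if "i \<in> I" for i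
    using norm_le[OF that] that cmod_power2[of "cnj w * z i"] by (simp add: complex_eq_iff)
  then have "cnj w * z j = cnj w * z k" using assms by simp
  then show ?thesis using nw c by auto
qed

lemma adjacency_matrix_ICG:
  "adjacency_matrix n (ICG n D) = circulant_mat n (\<lambda>x. if gcd x (int n) \<in> int ` D then 1 else 0)"
  by (auto simp: adjacency_matrix_def circulant_mat_def ICG_def intro!: cong_mat)

text \<open>Both gcds are powers of two dividing \<open>2 ^ i\<close>, so adding
  \<open>2 ^ i\<close> preserves the common divisors. Hence functions of the gcd are invariant under
  this shift off the multiples of \<open>2 ^ i\<close>.\<close>

lemma gcd_add_power_two:
  fixes t :: int
  assumes "i \<le> k" and "\<not> 2 ^ i dvd t"
  shows "gcd (t + 2 ^ i) (2 ^ k) = gcd t (2 ^ k)"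
proof -
  have dvd: "gcd s (2 ^ k) dvd 2 ^ i" if "\<not> 2 ^ i dvd s" for s :: int
  proof -
    obtain j where j: "gcd s (2 ^ k) = 2 ^ j"
      using divides_primepow[of "2 :: int" "gcd s (2 ^ k)" k] by auto
    have "\<not> i \<le> j"
      using that j by (metis dvd_trans gcd_dvd1 le_imp_power_dvd)
    then show ?thesis using j by (simp add: le_imp_power_dvd)
  qed
  have 1: "gcd t (2 ^ k) dvd 2 ^ i" using dvd assms(2) .
  have 2: "gcd (t + 2 ^ i) (2 ^ k) dvd 2 ^ i" using assms(2) by (intro dvd) simp
  show ?thesis
  proof (rule zdvd_antisym_nonneg)
    show "gcd (t + 2 ^ i) (2 ^ k) dvd gcd t (2 ^ k)"
      using 2 by (metis dvd_add_left_iff gcd_dvd1 gcd_dvd2 gcd_greatest)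
    show "gcd t (2 ^ k) dvd gcd (t + 2 ^ i) (2 ^ k)"
      using 1 by (metis dvd_add gcd_dvd1 gcd_dvd2 gcd_greatest)
  qed simp_all
qed

text \<open>Replacing \<open>s\<close> by \<open>- s\<close> undoes the conjugation of the
  character; thus the eigenvalues are real.\<close>

lemma cnj_fourier_even:
  assumes "n > 0" "\<And>x. f (x + int n) = f x" "\<And>x. f (- x) = f x" "\<And>x. cnj (f x) = f x"
  shows "cnj (fourier n f j) = fourier n f j"
proof -
  let ?g = "\<lambda>s. f s * unit_root n (- (j * s))"
  have "?g (s + int n) = ?g s" for s
    using assms unit_root_add[of n "- (j * s)" "- (j * int n)"] by (simp add: algebra_simps)
  from sum_periodic_uminus[of ?g, OF this] show ?thesis
    using assms by (simp add: fourier_def cnj_unit_root)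
qed

lemma fourier_uminus:
  assumes "n > 0" "\<And>x. f (x + int n) = f x" "\<And>x. f (- x) = f x" "\<And>x. cnj (f x) = f x"
  shows "fourier n f (- j) = fourier n f j"
proof -
  have "fourier n f (- j) = cnj (fourier n f j)"
    by (simp add: fourier_def cnj_unit_root assms(4))
  then show ?thesis using cnj_fourier_even[OF assms] by simp
qed

lemma circulant_state_transfer:
  assumes n: "n > 0" and per: "\<And>x. f (x + int n) = f x"
    and even: "\<And>x. f (- x) = f x" and real: "\<And>x. cnj (f x) = f x"
    and ab: "a < n" "b < n" "a \<noteq> b"
    and pst: "cmod (transition_matrix (circulant_mat n f) \<tau> $$ (a, b)) = 1"
  shows "exp (\<i> * \<tau> * fourier n f j) * unit_root n (j * (int a - int b)) = exp (\<i> * \<tau> * fourier n f 0)"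
    and "unit_root n (int a - int b) = - 1"
proof -
  define d where "d = int a - int b"
  define z where "z j = exp (\<i> * \<tau> * fourier n f j) * unit_root n (j * d)" for j
  \<comment> \<open>The scalar moves into the symbol: \<open>?g\<close> is again periodic, and its
    Fourier coefficients gain the same factor.\<close>
  let ?g = "\<lambda>x. \<i> * \<tau> * f x"
  have "(\<i> * \<tau>) \<cdot>\<^sub>m circulant_mat n f = circulant_mat n ?g"
    by (auto simp: circulant_mat_def)
  moreover have "fourier n ?g j = \<i> * \<tau> * fourier n f j" for j
    by (simp add: fourier_def sum_distrib_left mult.assoc)
  ultimately have "transition_matrix (circulant_mat n f) \<tau> $$ (a, b) = (\<Sum>j\<in>{0..<int n}. z j) / of_nat n"
    using mat_exp_circulant_entry[of n ?g a b] n per ab by (simp add: transition_matrix_def z_def d_def)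
  with pst n have norm_sum: "norm (\<Sum>j\<in>{0..<int n}. z j) = card {0..<int n}"
    by (simp add: norm_divide field_simps)
  have "Im (fourier n f j) = 0" for j
    using cnj_fourier_even[OF n per even real, of j] by (simp add: complex_eq_iff)
  then have unit: "norm (z j) = 1" for j
    by (simp add: z_def norm_mult)
  have z_per: "z (j + int n) = z j" for j
    using n by (simp add: z_def fourier_periodic distrib_right unit_root_add)
  have z_eq: "z j = z 0" for j
  proof -
    have "z (j mod int n) = z 0"
      by (rule norm_sum_eq_card_imp_eq[OF _ unit norm_sum]) (use n in auto)
    then show ?thesis using periodic_mod[of z, OF z_per] by simp
  qed
  then show "exp (\<i> * \<tau> * fourier n f j) * unit_root n (j * (int a - int b)) = exp (\<i> * \<tau> * fourier n f 0)"
    by (metis (no_types, lifting) z_def d_def mult_zero_left mult.right_neutral unit_root_0)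
  \<comment> \<open>The eigenvalues at 1 and -1 coincide, so their exponentials cancel and only the
    characters remain.\<close>
  have "z 1 = z (- 1)" using z_eq by metis
  then have "unit_root n d = unit_root n (- d)"
    by (simp add: z_def fourier_uminus[OF n per even real])
  moreover have "unit_root n d * unit_root n (- d) = 1"
    by (simp flip: unit_root_add)
  ultimately have "unit_root n d = 1 \<or> unit_root n d = - 1"
    by (metis power2_eq_1_iff power2_eq_square)
  moreover have "unit_root n d \<noteq> 1"
    using n ab by (simp add: unit_root_eq_1_iff d_def int_dvd_diff_iff)
  ultimately show "unit_root n (int a - int b) = - 1" by (simp add: d_def)
qed

section \<open>Fourier coefficients summed over residue classes, and those of power-of-two
  modulus\<close>

lemma sum_fourier_residue_class:
  assumes "M > 0" "N > 0"
  shows "(\<Sum>l\<in>{0..<int N}. fourier (M * N) f (r + int M * l))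
    = of_nat N * fourier M (\<lambda>t. f (int N * t)) r"
proof -
  let ?u = "unit_root (M * N)"
  let ?A = "{s\<in>{0..<int (M * N)}. int N dvd s}"
  have "(\<Sum>l\<in>{0..<int N}. fourier (M * N) f (r + int M * l))
    = (\<Sum>s\<in>{0..<int (M * N)}. f s * ?u (- (r * s)) * (\<Sum>l\<in>{0..<int N}. ?u (int M * (l * (- s)))))"
    unfolding fourier_def sum_distrib_left
    by (subst sum.swap) (simp add: algebra_simps flip: unit_root_add)
  \<comment> \<open>The inner sum runs over characters modulo \<open>N\<close>, so orthogonality
    kills every \<open>s\<close> not divisible by \<open>N\<close>.\<close>
  also have "\<dots> = (\<Sum>s\<in>{0..<int (M * N)}. if int N dvd s then of_nat N * (f s * ?u (- (r * s))) else 0)"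
    using assms unfolding unit_root_cancel[OF assms(1)]
    by (intro sum.cong) (simp_all only: sum_unit_root, simp_all)
  also have "\<dots> = (\<Sum>s\<in>?A. of_nat N * (f s * ?u (- (r * s))))"
    by (rule sum.inter_filter[symmetric]) simp
  also have "\<dots> = (\<Sum>t\<in>{0..<int M}. of_nat N * (f (int N * t) * ?u (- (r * (int N * t)))))"
    by (rule sum.reindex_bij_witness[where i = "\<lambda>t. int N * t" and j = "\<lambda>s. s div int N"])
      (use assms in \<open>auto simp: mult.commute zero_le_mult_iff elim!: dvdE\<close>)
  also have "\<dots> = of_nat N * fourier M (\<lambda>t. f (int N * t)) r"
  proof -
    have "?u (- (r * (int N * t))) = unit_root M (- (r * t))" for t
      using unit_root_cancel[of N M "- (r * t)"] assms by (simp add: mult_ac)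
    then show ?thesis by (simp add: fourier_def sum_distrib_left)
  qed
  finally show ?thesis .
qed

text \<open>The shift by \<open>2 ^ i\<close> negates the terms outside \<open>2 ^ i \<int>\<close> of the Fourier sum.\<close>

lemma fourier_power_two:
  assumes f: "\<And>t. f (gcd t (2 ^ k)) = f t" and "i \<le> k"
    and u: "unit_root (2 ^ k) (r * 2 ^ i) = - 1"
  shows "fourier (2 ^ k) f r = (\<Sum>t\<in>{t\<in>{0..<2 ^ k}. 2 ^ i dvd t}. f t * unit_root (2 ^ k) (- (r * t)))"
proof -
  let ?F = "\<lambda>t. f t * unit_root (2 ^ k) (- (r * t))"
  let ?G = "\<lambda>t. if 2 ^ i dvd t then 0 else ?F t"
  have per: "?G (t + 2 ^ k) = ?G t" for t
  proof -
    have "f (t + 2 ^ k) = f t" using f[of "t + 2 ^ k"] f[of t] by simp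
    moreover have "unit_root (2 ^ k) (- (r * (t + 2 ^ k))) = unit_root (2 ^ k) (- (r * t))"
      using unit_root_add[of "2 ^ k" "- (r * t)" "- (r * 2 ^ k)"] by (simp add: algebra_simps)
    moreover have "(2::int) ^ i dvd t + 2 ^ k \<longleftrightarrow> 2 ^ i dvd t"
      using \<open>i \<le> k\<close> by (simp add: dvd_add_left_iff le_imp_power_dvd)
    ultimately show ?thesis by simp
  qed
  have neg: "?G (t + 2 ^ i) = - ?G t" for t
  proof (cases "2 ^ i dvd t")
    case False
    have "unit_root (2 ^ k) (- (r * 2 ^ i)) = - 1"
      using u by (rule unit_root_uminus_eq)
    then have "unit_root (2 ^ k) (- (r * (t + 2 ^ i))) = - unit_root (2 ^ k) (- (r * t))"
      using unit_root_add[of "2 ^ k" "- (r * t)" "- (r * 2 ^ i)"] by (simp add: algebra_simps)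
    moreover have "f (t + 2 ^ i) = f t"
      using gcd_add_power_two[OF \<open>i \<le> k\<close> False] f by metis
    ultimately show ?thesis using False by simp
  qed simp
  \<comment> \<open>Shifting a full period leaves the sum unchanged but negates each term.\<close>
  have "sum ?G {0..<2 ^ k} = - sum ?G {0..<2 ^ k}"
    using sum_periodic_shift[of ?G "2 ^ k" "2 ^ i", OF per] by (simp only: neg sum_negf) simp
  then have "sum ?G {0..<2 ^ k} = 0" by simp
  moreover have "fourier (2 ^ k) f r
    = sum ?G {0..<2 ^ k} + (\<Sum>t\<in>{0..<2 ^ k}. if 2 ^ i dvd t then ?F t else 0)"
    unfolding fourier_def sum.distrib[symmetric] by (intro sum.cong) simp_all
  ultimately show ?thesis by (simp only: sum.inter_filter finite_atLeastLessThan_int add_0)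
qed

lemma multiples_below:
  fixes q :: int
  assumes "q > 0"
  shows "{t\<in>{0..<m * q}. q dvd t} = (\<lambda>x. q * x) ` {0..<m}"
  using assms by (auto simp: mult.commute zero_le_mult_iff elim!: dvdE)

text \<open>The shift \<open>2 ^ i\<close> is half the modulus, so only its multiples
  \<open>0\<close> and \<open>2 ^ i\<close> survive, with character values 1 and -1.\<close>

lemma fourier_power_two_1:
  fixes f :: "int \<Rightarrow> complex"
  assumes "\<And>t. f (gcd t (2 ^ (i + 1))) = f t"
  shows "fourier (2 ^ (i + 1)) f 1 = f 0 - f (2 ^ i)"
proof -
  have u: "unit_root (2 ^ (i + 1)) (2 ^ i) = - 1"
    using unit_root_half[of "2 ^ i"] by simp
  have "{0..<2} = {0, 1 :: int}" by auto
  then have m: "{t\<in>{0..<2 ^ (i + 1)}. 2 ^ i dvd t} = {0, 2 ^ i :: int}"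
    using multiples_below[of "2 ^ i" 2] by simp
  show ?thesis
    using fourier_power_two[of f "i + 1" i 1, OF assms] u unit_root_uminus_eq[OF u] unfolding m
    by simp
qed

text \<open>The shift \<open>2 ^ i\<close> is now a quarter of the modulus; its four multiples
  survive, with alternating character values.\<close>

lemma fourier_power_two_2:
  fixes f :: "int \<Rightarrow> complex"
  assumes "\<And>t. f (gcd t (2 ^ (i + 2))) = f t"
  shows "fourier (2 ^ (i + 2)) f 2 = f 0 - f (2 ^ i) + f (2 ^ (i + 1)) - f (3 * 2 ^ i)"
proof -
  let ?u = "unit_root (2 ^ (i + 2))"
  have u: "?u (2 * 2 ^ i) = - 1"
    using unit_root_half[of "2 ^ (i + 1)"] by simp
  then have u1: "?u (- (2 * 2 ^ i)) = - 1"
    by (rule unit_root_uminus_eq)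
  have u2: "?u (- (2 * (2 * 2 ^ i))) = 1"
    using unit_root_mult_of_nat[of "2 ^ (i + 2)" 2 "- (2 * 2 ^ i)"] u1 by simp
  have u3: "?u (- (2 * (3 * 2 ^ i))) = - 1"
    using unit_root_mult_of_nat[of "2 ^ (i + 2)" 3 "- (2 * 2 ^ i)"] u1 by simp
  have "{0..<4} = {0, 1, 2, 3 :: int}" by auto
  then have m: "{t\<in>{0..<2 ^ (i + 2)}. 2 ^ i dvd t} = {0, 2 ^ i, 2 * 2 ^ i, 3 * 2 ^ i :: int}"
    using multiples_below[of "2 ^ i" 4] by (simp add: mult.commute)
  show ?thesis
    using fourier_power_two[of f "i + 2" i 2, OF assms _ u] u1 u2 u3 unfolding m
    by simp
qed

section \<open>Integral circulant graphs of order divisible by 4\<close>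

theorem mainTheorem4:
  fixes n :: nat and D :: "nat set"
  assumes "n \<ge> 2" and "4 dvd n"
    and "D \<subseteq> {d. d dvd n \<and> 1 \<le> d \<and> d < n}"
    and "has_perfect_state_transfer n (ICG n D)"
  shows "(n div 2 \<in> D \<or> n div 4 \<in> D) \<and> \<not> (n div 2 \<in> D \<and> n div 4 \<in> D)"
proof -
  have n: "n > 0" using assms(1) by simp
  obtain N where "n = 2 ^ multiplicity 2 n * N" and "\<not> 2 dvd N"
    using multiplicity_decompose'[of n 2] n by auto
  moreover have "multiplicity 2 n \<ge> 2"
    using assms(2) n multiplicity_geI[of n 2 2] by simp
  then obtain i where "multiplicity 2 n = i + 2"
    by (metis le_add_diff_inverse2)
  ultimately have nN: "n = 2 ^ (i + 2) * N" and "odd N" by simp_all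
  then have N: "N > 0" using odd_pos by blast
  define f :: "int \<Rightarrow> complex" where "f x = (if gcd x (int n) \<in> int ` D then 1 else 0)" for x
  have per: "f (x + int n) = f x" for x by (simp add: f_def)
  have even: "f (- x) = f x" for x by (simp add: f_def)
  have real: "cnj (f x) = f x" for x by (simp add: f_def)
  obtain a b \<tau> where ab: "a < n" "b < n" "a \<noteq> b"
    and pst: "cmod (transition_matrix (circulant_mat n f) \<tau> $$ (a, b)) = 1"
    using assms(4) unfolding has_perfect_state_transfer_def adjacency_matrix_ICG f_def by blast
  let ?L = "fourier n f"
  let ?M = "2 ^ (i + 2) :: nat"
  define d where "d = int a - int b"
  define C where "C = exp (\<i> * \<tau> * ?L 0)"
  have phase: "exp (\<i> * \<tau> * ?L j) * unit_root n (j * d) = C" for j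
    using circulant_state_transfer(1)[OF n per even real ab pst] by (simp add: d_def C_def)
  have ud: "unit_root n d = - 1"
    using circulant_state_transfer(2)[OF n per even real ab pst] by (simp add: d_def)
  then have u2d: "unit_root n (2 * d) = 1"
    using unit_root_mult_of_nat[of n 2 d] by simp
  then have "int n dvd 2 * d" using n by (simp add: unit_root_eq_1_iff)
  \<comment> \<open>As \<open>?M\<close> is even, \<open>?M * l * d\<close> is a multiple of
    \<open>2 * d\<close>; so the character factor in \<open>phase\<close> depends only on
    \<open>j\<close> modulo \<open>?M\<close>.\<close>
  then have uM: "unit_root n (int ?M * l * d) = 1" for l
    using n dvd_mult[of "int n" "2 * d" "2 ^ (i + 1) * l"]
    by (intro unit_root_dvd) (simp_all add: mult_ac)
  define h where "h r = (\<Sum>l\<in>{0..<int N}. ?L (r + int ?M * l))" for r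
  have exp_h: "exp (\<i> * \<tau> * h r) = (\<Prod>l\<in>{0..<int N}. exp (\<i> * \<tau> * ?L (r + int ?M * l)))" for r
    by (simp add: h_def sum_distrib_left exp_sum)
  have "exp (\<i> * \<tau> * ?L (1 + int ?M * l)) = - C" for l
    using uM[of l] ud
    by (subst phase[of "1 + int ?M * l", symmetric]) (simp add: distrib_right unit_root_add)
  \<comment> \<open>The product has \<open>N\<close> factors \<open>- C\<close>, an odd
    number.\<close>
  then have "exp (\<i> * \<tau> * h 1) = - (C ^ N)"
    using \<open>odd N\<close> by (simp add: exp_h)
  moreover have "exp (\<i> * \<tau> * ?L (2 + int ?M * l)) = C" for l
    using phase[of "2 + int ?M * l"] uM[of l] u2d by (simp add: distrib_right unit_root_add)
  then have "exp (\<i> * \<tau> * h 2) = C ^ N"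
    by (simp add: exp_h)
  moreover have "C ^ N \<noteq> 0" by (simp add: C_def)
  ultimately have h_neq: "h 1 \<noteq> h 2" by auto
  define g where "g t = f (int N * t)" for t
  \<comment> \<open>Since \<open>n = 2 ^ (i + 2) * N\<close>, the gcd of \<open>N * t\<close> and
    \<open>n\<close> is \<open>N\<close> times that of \<open>t\<close> and
    \<open>2 ^ (i + 2)\<close>.\<close>
  have g_gcd: "g (gcd t (2 ^ (i + 2))) = g t" for t
    by (simp add: g_def f_def nN mult.commute[of _ "int N"] gcd_mult_distrib_int[symmetric])
  have h: "h r = of_nat N * fourier ?M g r" for r
    unfolding h_def nN g_def using N by (intro sum_fourier_residue_class) simp_all
  \<comment> \<open>Here \<open>gcd 0 n = n\<close>, while \<open>D\<close> contains only proper
    divisors.\<close>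
  have g0: "g 0 = 0" using assms(3) by (auto simp: g_def f_def)
  have "gcd (int N * 2 ^ (i + 1)) (int n) = int (n div 2)"
    by (subst gcd_proj1_if_dvd) (simp_all add: nN)
  then have g2: "g (2 ^ (i + 1)) = (if n div 2 \<in> D then 1 else 0)"
    by (simp add: g_def f_def image_iff)
  have "gcd (int N * 2 ^ i) (int n) = int (n div 4)"
    by (subst gcd_proj1_if_dvd) (simp_all add: nN)
  then have g1: "g (2 ^ i) = (if n div 4 \<in> D then 1 else 0)"
    by (simp add: g_def f_def image_iff)
  \<comment> \<open>\<open>3 * 2 ^ i * N\<close> is \<open>n - 2 ^ i * N\<close>, as
    \<open>n = 4 * 2 ^ i * N\<close>.\<close>
  have g3: "g (3 * 2 ^ i) = g (2 ^ i)"
    using per[of "- (int N * 2 ^ i)"] even[of "int N * 2 ^ i"] by (simp add: g_def nN algebra_simps)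
  have "fourier ?M g 1 = - g (2 ^ (i + 1))"
    using fourier_power_two_1[of g "i + 1"] g_gcd g0 by simp
  moreover have "fourier ?M g 2 = g (2 ^ (i + 1)) - 2 * g (2 ^ i)"
    using fourier_power_two_2[of g i] g_gcd g0 g3 by simp
  \<comment> \<open>If both values were \<open>x\<close>, both coefficients would be
    \<open>- x\<close>, making \<open>h 1\<close> and \<open>h 2\<close> equal.\<close>
  ultimately have "g (2 ^ (i + 1)) \<noteq> g (2 ^ i)"
    using h_neq by (auto simp: h)
  then show ?thesis unfolding g1 g2 by (auto split: if_splits)
qed

end
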